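(* For any positive integer $k$, the number of EVEN colored compositions of $k$ is equal to the number of $321$-avoiding separable permutations of $[k]=\{1,2,\dots,k\}$.
   Context: A composition of a positive integer $k$ is a finite ordered sequence of positive integers (called parts) whose sum is $k$; positions of parts are numbered $1,2,3,\dots$ from left to right. An EVEN colored composition of $k$ is a composition of $k$ in which each part in an even position (2nd, 4th, ...) of size $p$ is given one of $p$ colors $1,\dots,p$, while the parts in odd positions are not colored. A permutation avoids a pattern if it has no (not necessarily contiguous) subsequence with the same relative order as the pattern. A separable permutation is a permutation avoiding the patterns $2413$ and $3142$; it is $321$-avoiding if it also avoids the pattern $321$. *)

theory Defs
  imports "HOL-Library.Sublist" "HOL-Combinatorics.Multiset_Permutations"
begin

definition is_composition :: "nat \<Rightarrow> nat list \<Rightarrow> bool" where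
  "is_composition k ps \<longleftrightarrow> (\<forall>p \<in> set ps. 0 < p) \<and> sum_list ps = k"

text \<open>
  Each entry of the list is a part together with its optional color. List indices start at 0,
  so the entry with index \<open>i\<close> is the part in position \<open>i + 1\<close>.
\<close>

definition even_colored_compositions :: "nat \<Rightarrow> (nat \<times> nat option) list set" where
  "even_colored_compositions k =
     {cs. is_composition k (map fst cs) \<and>
          (\<forall>i < length cs.
             if even (i + 1) then (\<exists>c \<in> {1..fst (cs ! i)}. snd (cs ! i) = Some c)
             else snd (cs ! i) = None)}"

definition same_relative_order :: "nat list \<Rightarrow> nat list \<Rightarrow> bool" where
  "same_relative_order xs ys \<longleftrightarrow>
     length xs = length ys \<and>
     (\<forall>i < length xs. \<forall>j < length xs. xs ! i < xs ! j \<longleftrightarrow> ys ! i < ys ! j)"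

text \<open>Permutations and patterns are written in one-line notation.\<close>

definition avoids :: "nat list \<Rightarrow> nat list \<Rightarrow> bool" where
  "avoids w pat \<longleftrightarrow> \<not> (\<exists>v. subseq v w \<and> same_relative_order v pat)"

definition separable :: "nat list \<Rightarrow> bool" where
  "separable w \<longleftrightarrow> avoids w [2, 4, 1, 3] \<and> avoids w [3, 1, 4, 2]"

end

theory Submission
  imports Defs
begin

text \<open>
  A $321$-avoiding separable permutation is a direct sum of blocks, each of which is either a single
  point or a skew sum of two nonempty increasing sequences. Splitting off the first block gives
  $f(n+1) = f(n) + \sum_{q=1}^{n} q f(n-q)$, since there are $q$ blocks of size $q + 1 \ge 2$.
  Colored compositions satisfy the same recurrence: if the first part exceeds $1$, or is the only
  part, decrease it by $1$; otherwise remove it together with the second part, which has some size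
  $q$ and one of $q$ colors.
\<close>

section \<open>Even colored compositions\<close>

lemma even_colored_compositions_Nil:
  "[] \<in> even_colored_compositions k \<longleftrightarrow> k = 0"
  by (auto simp: even_colored_compositions_def is_composition_def)

lemma even_colored_compositions_single:
  "[x] \<in> even_colored_compositions k \<longleftrightarrow> x = (k, None) \<and> 0 < k"
  by (cases x) (auto simp: even_colored_compositions_def is_composition_def)

text \<open>Removing two parts preserves the parity of all later positions, so the tail is colored
  by the same rule.\<close>

lemma even_colored_compositions_Cons_Cons:
  "(p, d) # (q, e) # cs \<in> even_colored_compositions k \<longleftrightarrow>
     0 < p \<and> d = None \<and> p + q \<le> k \<and> (\<exists>c \<in> {1..q}. e = Some c) \<and>
     cs \<in> even_colored_compositions (k - p - q)"
  by (auto simp: even_colored_compositions_def is_composition_def All_less_Suc2)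

fun increase_first_part :: "(nat \<times> nat option) list \<Rightarrow> (nat \<times> nat option) list" where
  "increase_first_part [] = [(1, None)]"
| "increase_first_part ((p, d) # cs) = (Suc p, d) # cs"

lemma even_colored_compositions_cases:
  assumes "cs \<in> even_colored_compositions k"
  obtains (Nil) "cs = []" "k = 0"
  | (single) "cs = [(k, None)]" "0 < k"
  | (Cons_Cons) p q c cs' where "cs = (p, None) # (q, Some c) # cs'" "0 < p" "c \<in> {1..q}"
      "p + q \<le> k" "cs' \<in> even_colored_compositions (k - p - q)"
\<comment> \<open>Only the shape of this case rule matters: empty list, one entry, at least two
  entries.\<close>
proof (cases cs rule: remdups_adj.cases)
  case 1
  then show ?thesis
    using assms that(1) by (simp add: even_colored_compositions_Nil)
next
  case (2 x)
  then show ?thesis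
    using assms that(2) by (simp add: even_colored_compositions_single)
next
  case (3 x y zs)
  then show ?thesis
    using assms that(3)
    by (cases x; cases y) (auto simp: even_colored_compositions_Cons_Cons)
qed

lemma even_colored_compositions_0: "even_colored_compositions 0 = {[]}"
  by (auto elim: even_colored_compositions_cases simp: even_colored_compositions_Nil)

lemma even_colored_compositions_first_part:
  "(p, d) # cs \<in> even_colored_compositions k \<Longrightarrow> 0 < p"
  by (simp add: even_colored_compositions_def is_composition_def)

text \<open>Positivity of parts is what separates the image of \<open>[]\<close>, which starts with
  1, from all other images, whose first part is at least 2.\<close>

lemma inj_on_increase_first_part: "inj_on increase_first_part (even_colored_compositions k)"
proof (rule inj_onI)
  fix x y
  assume "x \<in> even_colored_compositions k" "y \<in> even_colored_compositions k"
    and "increase_first_part x = increase_first_part y"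
  then show "x = y"
    by (cases x rule: increase_first_part.cases; cases y rule: increase_first_part.cases)
      (auto dest: even_colored_compositions_first_part)
qed

lemma increase_first_part_in_even_colored_compositions:
  assumes "cs \<in> even_colored_compositions n"
  shows "increase_first_part cs \<in> even_colored_compositions (Suc n)"
  using assms
  by (cases rule: even_colored_compositions_cases)
    (auto simp: even_colored_compositions_single even_colored_compositions_Cons_Cons)

definition prepend_one_part ::
    "nat \<times> nat \<times> (nat \<times> nat option) list \<Rightarrow> (nat \<times> nat option) list" where
  "prepend_one_part = (\<lambda>(q, c, cs). (1, None) # (q, Some c) # cs)"

text \<open>A first part 1 followed by a second part gives the second image; every other composition
  arises by increasing a first part. For \<open>n = 0\<close> the value on \<open>[]\<close>
  supplies the only composition of 1.\<close>

lemma even_colored_compositions_Suc: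
  "even_colored_compositions (Suc n) =
     increase_first_part ` even_colored_compositions n \<union>
     prepend_one_part ` (SIGMA q:{1..n}. {1..q} \<times> even_colored_compositions (n - q))"
  (is "_ = ?A \<union> ?B")
proof (intro equalityI subsetI)
  fix cs assume "cs \<in> even_colored_compositions (Suc n)"
  then show "cs \<in> ?A \<union> ?B"
  proof (cases rule: even_colored_compositions_cases)
    case single
    show ?thesis
    \<comment> \<open>Decreasing a lone part 1 yields the empty list, not a part of size 0.\<close>
    proof (cases "n = 0")
      case True
      then show ?thesis
        using single by (simp add: even_colored_compositions_0)
    next
      case False
      then have "[(n, None)] \<in> even_colored_compositions n"
        by (simp add: even_colored_compositions_single)
      then show ?thesis
        using single by force
    qed
  next
    case (Cons_Cons p q c cs')
    show ?thesis
    proof (cases "p = 1")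
      case True
      then have "cs = prepend_one_part (q, c, cs')"
        using Cons_Cons by (simp add: prepend_one_part_def)
      then show ?thesis
        using Cons_Cons True by (intro UnI2 image_eqI[where x = "(q, c, cs')"]) auto
    next
      case False
      then obtain p' where p': "p = Suc p'" "0 < p'"
        using Cons_Cons(2) by (cases p) auto
      then have "(p', None) # (q, Some c) # cs' \<in> even_colored_compositions n"
        using Cons_Cons by (auto simp: even_colored_compositions_Cons_Cons)
      then show ?thesis
        using Cons_Cons(1) p' by force
    qed
  qed auto
next
  fix cs assume "cs \<in> ?A \<union> ?B"
  then show "cs \<in> even_colored_compositions (Suc n)"
    by (auto simp: prepend_one_part_def even_colored_compositions_Cons_Cons
        increase_first_part_in_even_colored_compositions)
qed

lemma finite_even_colored_compositions: "finite (even_colored_compositions k)"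
proof (induction k rule: less_induct)
  case (less k)
  show ?case
  proof (cases k)
    case 0
    then show ?thesis
      by (simp add: even_colored_compositions_0)
  next
    case (Suc n)
    then show ?thesis
      using less by (auto simp: even_colored_compositions_Suc intro!: finite_imageI finite_SigmaI)
  qed
qed

lemma card_even_colored_compositions_Suc:
  "card (even_colored_compositions (Suc n)) =
     card (even_colored_compositions n) +
     (\<Sum>q = 1..n. q * card (even_colored_compositions (n - q)))"
proof -
  let ?S = "SIGMA q:{1..n}. {1..q} \<times> even_colored_compositions (n - q)"
  have "inj_on prepend_one_part ?S"
    by (auto simp: inj_on_def prepend_one_part_def)
  moreover have "increase_first_part ` even_colored_compositions n \<inter> prepend_one_part ` ?S = {}"
  proof -
    \<comment> \<open>The left side is a single part or starts with a part of at least 2; the right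
      side starts with 1 and has a second part.\<close>
    have "increase_first_part x \<noteq> prepend_one_part y" if "x \<in> even_colored_compositions n" for x y
      using that by (cases x rule: increase_first_part.cases; cases y)
        (auto simp: prepend_one_part_def dest: even_colored_compositions_first_part)
    then show ?thesis
      by blast
  qed
  ultimately show ?thesis
    by (simp add: even_colored_compositions_Suc card_Un_disjoint card_image
        inj_on_increase_first_part finite_even_colored_compositions)
qed

section \<open>Pattern avoidance\<close>

lemma same_relative_order_321:
  "same_relative_order v [3, 2, 1] \<longleftrightarrow> (\<exists>p q r. v = [p, q, r] \<and> r < q \<and> q < p)"
  by (auto simp: same_relative_order_def All_less_Suc2 length_Suc_conv numeral_eq_Suc less_Suc_eq)

lemma same_relative_order_2413:
  "same_relative_order v [2, 4, 1, 3] \<longleftrightarrow>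
     (\<exists>p q r s. v = [p, q, r, s] \<and> r < p \<and> p < s \<and> s < q)"
  by (auto simp: same_relative_order_def All_less_Suc2 length_Suc_conv numeral_eq_Suc less_Suc_eq)

lemma same_relative_order_3142:
  "same_relative_order v [3, 1, 4, 2] \<longleftrightarrow>
     (\<exists>p q r s. v = [p, q, r, s] \<and> q < s \<and> s < p \<and> p < r)"
  by (auto simp: same_relative_order_def All_less_Suc2 length_Suc_conv numeral_eq_Suc less_Suc_eq)

definition separable_321_avoiding :: "nat list \<Rightarrow> bool" where
  "separable_321_avoiding w \<longleftrightarrow> separable w \<and> avoids w [3, 2, 1]"

text \<open>Each chain lists the pattern entries by increasing value; transitivity settles the
  remaining comparisons.\<close>

lemma separable_321_avoiding_iff:
  "separable_321_avoiding w \<longleftrightarrow>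
     (\<forall>p q r. subseq [p, q, r] w \<longrightarrow> \<not> (r < q \<and> q < p)) \<and>
     (\<forall>p q r s. subseq [p, q, r, s] w \<longrightarrow> \<not> (r < p \<and> p < s \<and> s < q)) \<and>
     (\<forall>p q r s. subseq [p, q, r, s] w \<longrightarrow> \<not> (q < s \<and> s < p \<and> p < r))"
  unfolding separable_321_avoiding_def separable_def avoids_def same_relative_order_321
    same_relative_order_2413 same_relative_order_3142 by blast

lemma separable_321_avoiding_subseq:
  assumes "separable_321_avoiding w" "subseq v w"
  shows "separable_321_avoiding v"
  using assms unfolding separable_321_avoiding_iff by (meson subseq_order.order_trans)

lemma set_mono_subseq: "subseq xs ys \<Longrightarrow> set xs \<subseteq> set ys"
  by (induction rule: list_emb.induct) auto

lemma subseq_distinct: "subseq xs ys \<Longrightarrow> distinct ys \<Longrightarrow> distinct xs"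
  using subseqs_distinctD by (metis in_set_subseqs)

text \<open>If \<open>v\<close> met both summands, all pairs across the cut would satisfy
  \<open>R\<close>, against the last assumption. With \<open>R\<close> as \<open><\<close>, an
  occurrence of a sum-indecomposable pattern in a direct sum stays within one summand.\<close>

lemma subseq_append_indecomposable:
  assumes "subseq v (xs @ ys)"
    and "\<And>x y. x \<in> set xs \<Longrightarrow> y \<in> set ys \<Longrightarrow> R x y"
    and "\<And>v1 v2. v = v1 @ v2 \<Longrightarrow> v1 \<noteq> [] \<Longrightarrow> v2 \<noteq> [] \<Longrightarrow>
      \<exists>x \<in> set v1. \<exists>y \<in> set v2. \<not> R x y"
  shows "subseq v xs \<or> subseq v ys"
proof -
  obtain v1 v2 where v: "v = v1 @ v2" "subseq v1 xs" "subseq v2 ys"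
    using assms(1) by (rule subseq_appendE)
  then have "\<forall>x \<in> set v1. \<forall>y \<in> set v2. R x y"
    using assms(2) set_mono_subseq by blast
  then have "v1 = [] \<or> v2 = []"
    using assms(3) v(1) by blast
  then show ?thesis
    using v by auto
qed

text \<open>The patterns 321, 2413 and 3142 are all sum-indecomposable: every cut has a larger entry
  before it and a smaller one after it.\<close>

lemma separable_321_avoiding_append:
  assumes "separable_321_avoiding xs" "separable_321_avoiding ys"
    and less: "\<And>x y. x \<in> set xs \<Longrightarrow> y \<in> set ys \<Longrightarrow> x < y"
  shows "separable_321_avoiding (xs @ ys)"
  unfolding separable_321_avoiding_iff
proof (intro conjI allI impI notI; elim conjE)
  fix p q r assume "subseq [p, q, r] (xs @ ys)" and ord: "r < q" "q < p"
  from this(1) less have "subseq [p, q, r] xs \<or> subseq [p, q, r] ys"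
    by (rule subseq_append_indecomposable) (use ord in \<open>auto simp: Cons_eq_append_conv\<close>)
  then show False
    using assms(1,2) ord unfolding separable_321_avoiding_iff by meson
next
  fix p q r s assume "subseq [p, q, r, s] (xs @ ys)" and ord: "r < p" "p < s" "s < q"
  from this(1) less have "subseq [p, q, r, s] xs \<or> subseq [p, q, r, s] ys"
    by (rule subseq_append_indecomposable) (use ord in \<open>auto simp: Cons_eq_append_conv\<close>)
  then show False
    using assms(1,2) ord unfolding separable_321_avoiding_iff by meson
next
  fix p q r s assume "subseq [p, q, r, s] (xs @ ys)" and ord: "q < s" "s < p" "p < r"
  from this(1) less have "subseq [p, q, r, s] xs \<or> subseq [p, q, r, s] ys"
    by (rule subseq_append_indecomposable) (use ord in \<open>auto simp: Cons_eq_append_conv\<close>)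
  then show False
    using assms(1,2) ord unfolding separable_321_avoiding_iff by meson
qed

lemma sorted_wrt_subseq:
  assumes "sorted_wrt R ys" "subseq xs ys"
  shows "sorted_wrt R xs"
  using assms(2,1) by (induction rule: list_emb.induct) (auto dest: set_mono_subseq)

text \<open>Reduces sortedness to pairs of entries, so that it follows by extending a descent to a
  forbidden pattern.\<close>

lemma sorted_wrt_iff_subseq:
  "sorted_wrt R xs \<longleftrightarrow> (\<forall>x y. subseq [x, y] xs \<longrightarrow> R x y)"
proof
  show "\<forall>x y. subseq [x, y] xs \<longrightarrow> R x y" if "sorted_wrt R xs"
    using that by (auto dest: sorted_wrt_subseq)
next
  assume "\<forall>x y. subseq [x, y] xs \<longrightarrow> R x y"
  then show "sorted_wrt R xs"
  proof (induction xs)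
    case (Cons a xs)
    have "R a y" if "y \<in> set xs" for y
      using that Cons.prems by (auto simp: subseq_singleton_left)
    moreover have "sorted_wrt R xs"
      using Cons list_emb_Cons by blast
    ultimately show ?case
      by simp
  qed simp
qed

text \<open>Subsequences inherit the decomposition into two increasing runs, the first above the
  second. However a forbidden pattern is cut, one piece has a descent or some pair rises across the
  cut.\<close>

lemma separable_321_avoiding_skew_sum:
  assumes "sorted_wrt (<) xs" "sorted_wrt (<) ys"
    and greater: "\<And>x y. x \<in> set xs \<Longrightarrow> y \<in> set ys \<Longrightarrow> x > y"
  shows "separable_321_avoiding (xs @ ys)"
proof -
  have split: "\<exists>v1 v2. v = v1 @ v2 \<and> sorted_wrt (<) v1 \<and> sorted_wrt (<) v2 \<and>
      (\<forall>x \<in> set v1. \<forall>y \<in> set v2. y < x)" if v: "subseq v (xs @ ys)" for v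
  proof -
    obtain v1 v2 where v1_v2: "v = v1 @ v2" "subseq v1 xs" "subseq v2 ys"
      using v by (rule subseq_appendE)
    then have "\<forall>x \<in> set v1. \<forall>y \<in> set v2. y < x"
      using greater set_mono_subseq by blast
    then show ?thesis
      using v1_v2 assms(1,2) sorted_wrt_subseq by blast
  qed
  show ?thesis
    unfolding separable_321_avoiding_iff
    by (intro conjI allI impI notI; drule split) (auto simp: Cons_eq_append_conv)
qed

section \<open>The first block of a permutation\<close>

text \<open>
  Permutations of arbitrary intervals, so that removing the first block needs no relabelling.
\<close>

definition separable_321_avoiders :: "nat \<Rightarrow> nat \<Rightarrow> nat list set" where
  "separable_321_avoiders m k =
     {w \<in> permutations_of_set {m..<m + k}. separable_321_avoiding w}"

lemma finite_separable_321_avoiders: "finite (separable_321_avoiders m k)"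
  by (simp add: separable_321_avoiders_def)

lemma separable_321_avoiders_0: "separable_321_avoiders m 0 = {[]}"
  by (auto simp: separable_321_avoiders_def separable_321_avoiding_iff)

lemma mem_separable_321_avoiders:
  "w \<in> separable_321_avoiders m k \<longleftrightarrow>
     distinct w \<and> set w = {m..<m + k} \<and> separable_321_avoiding w"
  by (auto simp: separable_321_avoiders_def permutations_of_set_def)

text \<open>The block has \<open>q + 1\<close> entries, the \<open>b\<close> smallest of them placed
  last. Both runs are nonempty exactly for \<open>b\<close> from 1 to \<open>q\<close>, which gives
  the factor \<open>q\<close> in the recurrence.\<close>

definition prepend_skew_block :: "nat \<Rightarrow> nat \<times> nat \<times> nat list \<Rightarrow> nat list" where
  "prepend_skew_block m = (\<lambda>(q, b, w). [m + b..<m + Suc q] @ [m..<m + b] @ w)"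

text \<open>No entry with \<open>P\<close> comes after one without it, so the entries with
  \<open>P\<close> form a prefix.\<close>

lemma append_filter_if_subseq_closed:
  assumes "\<And>x y. subseq [x, y] xs \<Longrightarrow> P y \<Longrightarrow> P x"
  shows "xs = filter P xs @ filter (\<lambda>x. \<not> P x) xs"
  using assms
proof (induction xs)
  case (Cons a xs)
  have IH: "xs = filter P xs @ filter (\<lambda>x. \<not> P x) xs"
    using Cons list_emb_Cons by blast
  show ?case
  proof (cases "P a")
    case True
    then show ?thesis
      using IH by simp
  next
    case False
    then have "\<forall>x \<in> set xs. \<not> P x"
      using Cons.prems[of a] by (auto simp: subseq_singleton_left)
    then show ?thesis
      using False by simp
  qed
qed simp

lemma strict_sorted_eq_upt:
  assumes "sorted_wrt (<) xs" "set xs = {a..<b}"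
  shows "xs = [a..<b]"
  using assms by (intro strict_sorted_equal) auto

text \<open>Cut the word at its minimum \<open>m\<close>. Avoiding 321 and 2413 makes the entries
  before \<open>m\<close> a run of consecutive values; avoiding 3142 and 321 makes the values below
  \<open>h\<close> an increasing run directly after it. The rest lies above both runs.\<close>

lemma separable_321_avoiders_first_block:
  assumes w: "h # t \<in> separable_321_avoiders m (Suc n)" and "h \<noteq> m"
  shows "h # t \<in> prepend_skew_block m `
    (SIGMA q:{1..n}. {1..q} \<times> separable_321_avoiders (m + Suc q) (n - q))"
proof -
  let ?w = "h # t"
  have dist: "distinct ?w" and set_w: "set ?w = {m..<m + Suc n}" and good: "separable_321_avoiding ?w"
    using w by (simp_all only: mem_separable_321_avoiders)
  have no_321: False if "subseq [p, q, r] ?w" "r < q" "q < p" for p q r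
    using good that unfolding separable_321_avoiding_iff by meson
  have no_2413: False if "subseq [p, q, r, s] ?w" "r < p" "p < s" "s < q" for p q r s
    using good that unfolding separable_321_avoiding_iff by meson
  have no_3142: False if "subseq [p, q, r, s] ?w" "q < s" "s < p" "p < r" for p q r s
    using good that unfolding separable_321_avoiding_iff by meson
  have "h \<in> set ?w"
    by simp
  then have "m < h"
    using \<open>h \<noteq> m\<close> unfolding set_w by simp
  have "m \<in> set ?w"
    unfolding set_w by simp
  then have "m \<in> set t"
    using \<open>h \<noteq> m\<close> by simp
  then obtain u v where t: "t = u @ m # v"
    by (meson split_list)
  have mem_w: "x \<in> set ?w \<longleftrightarrow> m \<le> x \<and> x < m + Suc n" for x
    unfolding set_w by simp
  have split_w: "x \<in> set ?w \<longleftrightarrow> x \<in> set (h # u) \<or> x \<in> set (m # v)" for x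
    using t by auto
  \<comment> \<open>All patterns through \<open>m\<close> below are built from entries chosen before
    and after it.\<close>
  have left: "subseq (xs @ m # ys) ?w" if "subseq xs (h # u)" "subseq ys v" for xs ys
    using list_emb_append_mono[OF that(1), of "m # ys" "m # v"] that(2) t by simp

  \<comment> \<open>A descent before \<open>m\<close>, followed by \<open>m\<close>, is a
    321.\<close>
  have sorted_u: "sorted_wrt (<) (h # u)"
    unfolding sorted_wrt_iff_subseq
  proof (intro allI impI)
    fix x y assume xy: "subseq [x, y] (h # u)"
    have "subseq [x, y, m] ?w"
      using left[OF xy, of "[]"] by simp
    moreover have "y \<in> set (h # u)"
      using set_mono_subseq[OF xy] by simp
    then have "y \<noteq> m" "y \<in> set ?w"
      using dist \<open>h \<noteq> m\<close> t by auto
    then have "m < y"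
      unfolding mem_w by simp
    moreover have "x \<noteq> y"
      using subseq_distinct[OF xy] dist t by simp
    ultimately show "x < y"
      using no_321[of x y m] by fastforce
  qed
  \<comment> \<open>The least value above the first block.\<close>
  define c where "c = Suc (Max (set (h # u)))"
  have Max_mem: "Max (set (h # u)) \<in> set (h # u)"
    by (rule Max_in) auto
  have upper: "set (h # u) \<subseteq> {h..<c}"
    using sorted_u by (auto simp: c_def less_Suc_eq_le intro: Max_ge)
  \<comment> \<open>A missing value \<open>y\<close> between \<open>h\<close> and \<open>x\<close>
    would come after \<open>m\<close>, and \<open>h, x, m, y\<close> would be a 2413.\<close>
  have down_closed: "y \<in> set (h # u)" if "x \<in> set (h # u)" "h \<le> y" "y \<le> x" for x y
  proof (rule ccontr)
    assume y: "y \<notin> set (h # u)"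
    then have "y \<noteq> h" "y \<noteq> x"
      using that(1) by auto
    then have "h < y" "y < x"
      using that(2,3) by simp_all
    have "x \<in> set ?w"
      using that(1) split_w by blast
    then have "y \<in> set ?w"
      using \<open>m < h\<close> \<open>h < y\<close> \<open>y < x\<close> unfolding mem_w by simp
    then have "y \<in> set v"
      using y \<open>m < h\<close> \<open>h < y\<close> split_w[of y] by auto
    moreover have "x \<in> set u"
      using that(1,3) \<open>h < y\<close> by auto
    ultimately have "subseq [h, x, m, y] ?w"
      using left[of "[h, x]" "[y]"] by (simp add: subseq_singleton_left)
    then show False
      using no_2413[of h x m y] \<open>m < h\<close> \<open>h < y\<close> \<open>y < x\<close> by simp
  qed
  have lower: "{h..<c} \<subseteq> set (h # u)"
  proof
    fix y assume "y \<in> {h..<c}"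
    then have "h \<le> y" "y \<le> Max (set (h # u))"
      unfolding c_def atLeastLessThan_iff less_Suc_eq_le by blast+
    then show "y \<in> set (h # u)"
      by (rule down_closed[OF Max_mem])
  qed
  have set_u: "set (h # u) = {h..<c}"
    using upper lower by (rule subset_antisym)
  have u: "h # u = [h..<c]"
    using sorted_u set_u by (rule strict_sorted_eq_upt)

  \<comment> \<open>The lower run of the block, and what remains after the block.\<close>
  let ?s = "filter (\<lambda>x. x < h) (m # v)" and ?l = "filter (\<lambda>x. \<not> x < h) (m # v)"
  \<comment> \<open>An entry \<open>x\<close> above \<open>h\<close> before an entry
    \<open>y\<close> below \<open>h\<close> would make \<open>h, m, x, y\<close> a 3142.\<close>
  have ms: "m # v = ?s @ ?l"
  proof (rule append_filter_if_subseq_closed)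
    fix x y assume xy: "subseq [x, y] (m # v)" and "y < h"
    show "x < h"
    proof (rule ccontr)
      assume "\<not> x < h"
      then have "x \<noteq> m"
        using \<open>m < h\<close> by simp
      then have "subseq [x, y] v"
        using xy by simp
      then have "subseq [h, m, x, y] ?w"
        using left[of "[h]" "[x, y]"] by simp
      moreover have "{x, y} \<subseteq> set v"
        using set_mono_subseq[OF \<open>subseq [x, y] v\<close>] by simp
      then have "x \<noteq> h" "y \<noteq> m" "y \<in> set ?w"
        using dist t by auto
      then have "h < x" "m < y"
        using \<open>\<not> x < h\<close> mem_w[of y] by simp_all
      ultimately show False
        using no_3142[of h m x y] \<open>y < h\<close> by simp
    qed
  qed
  have "x \<in> set ?s \<longleftrightarrow> x \<in> {m..<h}" for x
  proof -
    have "x \<in> set ?w" if "m \<le> x" "x < h"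
      using that mem_w[of x] mem_w[of h] by simp
    moreover have "x \<notin> set (h # u)" if "x < h"
      unfolding set_u using that by simp
    moreover have "x \<in> set ?s \<longleftrightarrow> x \<in> set (m # v) \<and> x < h"
      by auto
    ultimately show ?thesis
      using split_w[of x] mem_w[of x] unfolding atLeastLessThan_iff by blast
  qed
  then have set_s: "set ?s = {m..<h}"
    by blast
  \<comment> \<open>A descent below \<open>h\<close>, preceded by \<open>h\<close>, is a
    321.\<close>
  have sorted_s: "sorted_wrt (<) ?s"
    unfolding sorted_wrt_iff_subseq
  proof (intro allI impI)
    fix x y assume xy: "subseq [x, y] ?s"
    then have "subseq [x, y] (m # v)"
      using subseq_filter_left subseq_order.trans by blast
    then have "subseq [h, x, y] ?w"
      using t by (simp add: list_emb_append2)
    moreover have "x < h"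
      using set_mono_subseq[OF xy] unfolding set_s by simp
    moreover have "x \<noteq> y"
      using subseq_distinct[OF \<open>subseq [h, x, y] ?w\<close> dist] by simp
    ultimately show "x < y"
      using no_321[of h x y] by fastforce
  qed
  have s: "?s = [m..<h]"
    using sorted_s set_s by (rule strict_sorted_eq_upt)

  have w_eq: "?w = [h..<c] @ [m..<h] @ ?l"
    using t u ms s by (metis append_Cons)
  have "h < c" "c \<le> m + Suc n"
  proof -
    have "Max (set (h # u)) \<in> set ?w"
      using Max_mem split_w by blast
    then show "c \<le> m + Suc n"
      unfolding mem_w c_def Suc_le_eq by (rule conjunct2)
    have "h \<in> set (h # u)"
      by simp
    then show "h < c"
      unfolding set_u by simp
  qed
  \<comment> \<open>The two runs use up the values from \<open>m\<close> to \<open>c - 1\<close>,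
    and by distinctness none recurs.\<close>
  have "x \<in> set ?l \<longleftrightarrow> x \<in> {c..<m + Suc n}" for x
  proof -
    have "x \<in> set ?w \<longleftrightarrow> x \<in> {h..<c} \<or> x \<in> {m..<h} \<or> x \<in> set ?l"
      unfolding w_eq by simp
    moreover have "x \<notin> {h..<c}" "x \<notin> {m..<h}" if "x \<in> set ?l"
      using that dist unfolding w_eq by (auto simp del: filter.simps set_filter)
    ultimately show ?thesis
      using mem_w[of x] \<open>m < h\<close> \<open>h < c\<close> unfolding atLeastLessThan_iff
      by (metis leD le_trans less_imp_le_nat not_le_imp_less)
  qed
  then have "set ?l = {c..<m + Suc n}"
    by blast
  moreover have "subseq ?l ?w"
    by (metis w_eq append.assoc list_emb_append2 subseq_order.refl)
  ultimately have "?l \<in> separable_321_avoiders c (m + Suc n - c)"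
    using dist good \<open>c \<le> m + Suc n\<close> unfolding mem_separable_321_avoiders
    by (metis le_add_diff_inverse separable_321_avoiding_subseq subseq_distinct)
  moreover obtain q b where "c = m + Suc q" "h = m + b"
    using \<open>m < h\<close> \<open>h < c\<close> by (metis less_imp_Suc_add add_Suc_right less_imp_add_positive less_trans)
  ultimately have "(q, b, ?l) \<in>
      (SIGMA q:{1..n}. {1..q} \<times> separable_321_avoiders (m + Suc q) (n - q))"
    using \<open>m < h\<close> \<open>h < c\<close> \<open>c \<le> m + Suc n\<close> by simp
  moreover have "?w = prepend_skew_block m (q, b, ?l)"
    unfolding prepend_skew_block_def prod.case \<open>c = m + Suc q\<close>[symmetric] \<open>h = m + b\<close>[symmetric]
    by (rule w_eq)
  ultimately show ?thesis
    by (rule rev_image_eqI)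
qed

lemma separable_321_avoiders_Suc:
  "separable_321_avoiders m (Suc n) =
     Cons m ` separable_321_avoiders (Suc m) n \<union>
     prepend_skew_block m `
       (SIGMA q:{1..n}. {1..q} \<times> separable_321_avoiders (m + Suc q) (n - q))"
  (is "_ = ?A \<union> ?B")
proof (intro equalityI subsetI)
  fix w assume w: "w \<in> separable_321_avoiders m (Suc n)"
  then obtain h t where ht: "w = h # t"
    by (cases w) (auto simp: mem_separable_321_avoiders)
  show "w \<in> ?A \<union> ?B"
  proof (cases "h = m")
    case True
    have dist: "distinct (m # t)" and set_w: "set (m # t) = {m..<m + Suc n}"
      and good: "separable_321_avoiding (m # t)"
      using w unfolding ht True by (simp_all only: mem_separable_321_avoiders)
    have "set t = set (m # t) - {m}"
      using dist by simp
    also have "\<dots> = {Suc m..<Suc m + n}"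
      unfolding set_w by auto
    finally have "t \<in> separable_321_avoiders (Suc m) n"
      using dist good
      by (auto simp: mem_separable_321_avoiders elim: separable_321_avoiding_subseq)
    then show ?thesis
      using ht True by blast
  next
    case False
    then show ?thesis
      using separable_321_avoiders_first_block w ht by blast
  qed
next
  fix w assume "w \<in> ?A \<union> ?B"
  then show "w \<in> separable_321_avoiders m (Suc n)"
  proof
    assume "w \<in> ?A"
    then obtain t where t: "w = [m] @ t" "t \<in> separable_321_avoiders (Suc m) n"
      by (metis append_Cons append_Nil imageE)
    moreover have "separable_321_avoiding [m]"
      using separable_321_avoiding_skew_sum[of "[m]" "[]"] by simp
    then have "separable_321_avoiding ([m] @ t)"
      using t by (intro separable_321_avoiding_append) (auto simp: mem_separable_321_avoiders)
    ultimately show ?thesis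
      by (auto simp: mem_separable_321_avoiders)
  next
    assume "w \<in> ?B"
    then obtain q b t where q: "q \<in> {1..n}" "b \<in> {1..q}"
      and t: "t \<in> separable_321_avoiders (m + Suc q) (n - q)"
      and w: "w = ([m + b..<m + Suc q] @ [m..<m + b]) @ t"
      by (auto simp: prepend_skew_block_def)
    then have t': "distinct t" "set t = {m + Suc q..<m + Suc n}" "separable_321_avoiding t"
      using q by (simp_all add: mem_separable_321_avoiders)
    have "separable_321_avoiding ([m + b..<m + Suc q] @ [m..<m + b])"
      by (rule separable_321_avoiding_skew_sum) (simp_all del: upt_Suc)
    then have "separable_321_avoiding w"
      unfolding w using t'(3) by (rule separable_321_avoiding_append) (use q t'(2) in auto)
    moreover have "distinct w"
      unfolding w using t'(1,2) q by (auto simp del: upt_Suc)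
    moreover have "set w = {m..<m + Suc n}"
      unfolding w set_append t'(2) set_upt using q by auto
    ultimately show ?thesis
      by (simp add: mem_separable_321_avoiders)
  qed
qed

lemma hd_prepend_skew_block: "b \<le> q \<Longrightarrow> hd (prepend_skew_block m (q, b, w)) = m + b"
  by (simp add: prepend_skew_block_def upt_conv_Cons del: upt_Suc)

lemma inj_on_prepend_skew_block:
  "inj_on (prepend_skew_block m) (SIGMA q:Q. {1..q} \<times> W q)"
proof -
  have run: "takeWhile (\<lambda>x. x \<noteq> m) (prepend_skew_block m (q, b, w)) = [m + b..<m + Suc q]"
    if "1 \<le> b" for q b w
  proof -
    have "[m..<m + b] = m # [Suc m..<m + b]"
      using that by (simp add: upt_conv_Cons)
    moreover have "x \<noteq> m" if "x \<in> set [m + b..<m + Suc q]" for x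
      using that \<open>1 \<le> b\<close> unfolding set_upt by auto
    then have "takeWhile (\<lambda>x. x \<noteq> m) ([m + b..<m + Suc q] @ m # [Suc m..<m + b] @ w) =
        [m + b..<m + Suc q] @ takeWhile (\<lambda>x. x \<noteq> m) (m # [Suc m..<m + b] @ w)"
      by (rule takeWhile_append2)
    ultimately show ?thesis
      by (simp add: prepend_skew_block_def del: upt_Suc)
  qed
  show ?thesis
  proof (rule inj_onI)
    fix x y
    assume eq: "prepend_skew_block m x = prepend_skew_block m y"
      and mem: "x \<in> (SIGMA q:Q. {1..q} \<times> W q)" "y \<in> (SIGMA q:Q. {1..q} \<times> W q)"
    obtain q b w where x: "x = (q, b, w)"
      by (rule prod_cases3)
    obtain q' b' w' where y: "y = (q', b', w')"
      by (rule prod_cases3)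
    have b: "1 \<le> b" "b \<le> q" "1 \<le> b'" "b' \<le> q'"
      using mem unfolding x y by simp_all
    have "m + b = m + b'"
      using eq hd_prepend_skew_block b(2,4) unfolding x y by metis
    then have "b = b'"
      by simp
    have "[m + b..<m + Suc q] = [m + b'..<m + Suc q']"
      using eq run b(1,3) unfolding x y by metis
    then have "length [m + b..<m + Suc q] = length [m + b'..<m + Suc q']"
      by (rule arg_cong)
    then have "q = q'"
      using b \<open>b = b'\<close> by (simp only: length_upt)
    then show "x = y"
      using eq \<open>b = b'\<close> by (simp add: x y prepend_skew_block_def)
  qed
qed

lemma card_separable_321_avoiders_Suc:
  "card (separable_321_avoiders m (Suc n)) =
     card (separable_321_avoiders (Suc m) n) +
     (\<Sum>q = 1..n. q * card (separable_321_avoiders (m + Suc q) (n - q)))"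
proof -
  let ?S = "SIGMA q:{1..n}. {1..q} \<times> separable_321_avoiders (m + Suc q) (n - q)"
  have "x \<noteq> y"
    if "x \<in> Cons m ` separable_321_avoiders (Suc m) n" "y \<in> prepend_skew_block m ` ?S" for x y
  proof -
    have "hd x = m" "hd y \<noteq> m"
      using that by (auto simp: hd_prepend_skew_block)
    then show ?thesis
      by auto
  qed
  then have "Cons m ` separable_321_avoiders (Suc m) n \<inter> prepend_skew_block m ` ?S = {}"
    by blast
  moreover have "card (prepend_skew_block m ` ?S) = card ?S"
    by (rule card_image[OF inj_on_prepend_skew_block])
  ultimately show ?thesis
    by (simp add: separable_321_avoiders_Suc card_Un_disjoint card_image
        finite_separable_321_avoiders)
qed

lemma card_separable_321_avoiders:
  "card (separable_321_avoiders m k) = card (even_colored_compositions k)"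
proof (induction k arbitrary: m rule: less_induct)
  case (less k)
  show ?case
  proof (cases k)
    case 0
    then show ?thesis
      by (simp add: separable_321_avoiders_0 even_colored_compositions_0)
  next
    case (Suc n)
    then show ?thesis
      using less by (simp add: card_separable_321_avoiders_Suc card_even_colored_compositions_Suc)
  qed
qed

theorem theorem3p7:
  fixes k :: nat
  assumes "k > 0"
  shows "card (even_colored_compositions k) =
    card {w \<in> permutations_of_set {1..k}. separable w \<and> avoids w [3, 2, 1]}"
proof -
  have "{w \<in> permutations_of_set {1..k}. separable w \<and> avoids w [3, 2, 1]} =
      separable_321_avoiders 1 k"
    by (simp add: separable_321_avoiders_def separable_321_avoiding_def
        atLeastLessThanSuc_atLeastAtMost)
  then show ?thesis
    by (simp add: card_separable_321_avoiders)
qed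

end
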